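(* Let $p(n,a)$ be the number of $a$-parking functions of length $n$. Then for all integers $n\ge1$, $a\ge 1$, $$p(n,a)=\sum_{k=0}^{n}\binom{n}{k}\,p(n-k,a+k-1),$$ subject to the boundary conditions $p(n,0)=0$ for $n\ge1$ and $p(0,a)=1$ for $a\ge0$.
   Context: For integers $n\ge 0$, $a\ge0$, a vector of positive integers $(p_1,\dots,p_n)$ with $1\le p_i\le n+a-1$ is an $a$-parking function of length $n$ if its non-decreasing rearrangement $p_{(1)}\le p_{(2)}\le\dots\le p_{(n)}$ satisfies $p_{(i)}\le a+i-1$ for all $1\le i\le n$. (The empty vector is the unique $a$-parking function of length $0$.) *)

theory Defs
  imports Main
begin

text \<open>
  Vectors of positive integers are lists of natural numbers. The order statistic
  $p_{(i)}$ (indexed from 1) is \<open>sort ps ! (i - 1)\<close>. No subtraction below truncates: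
  an entry exists only if \<open>length ps \<ge> 1\<close>, and \<open>i \<ge> 1\<close>.
\<close>

definition parking_function :: "nat \<Rightarrow> nat list \<Rightarrow> bool" where
  "parking_function a ps \<longleftrightarrow>
     (\<forall>x\<in>set ps. 1 \<le> x \<and> x \<le> length ps + a - 1) \<and>
     (\<forall>i\<in>{1..length ps}. sort ps ! (i - 1) \<le> a + i - 1)"

definition parking_functions :: "nat \<Rightarrow> nat \<Rightarrow> nat list set" where
  "parking_functions n a = {ps. length ps = n \<and> parking_function a ps}"

text \<open>The set being counted is finite, so \<open>card\<close> is not a junk value.\<close>

lemma finite_parking_functions: "finite (parking_functions n a)"
proof (rule finite_subset)
  show "parking_functions n a \<subseteq> {ps. set ps \<subseteq> {1..n + a - 1} \<and> length ps = n}"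
    by (auto simp: parking_functions_def parking_function_def)
  show "finite {ps. set ps \<subseteq> {1..n + a - 1} \<and> length ps = n}"
    by (rule finite_lists_length_eq) simp
qed

definition num_parking :: "nat \<Rightarrow> nat \<Rightarrow> nat" where
  "num_parking n a = card (parking_functions n a)"

end

theory Submission
  imports Defs "HOL-Library.Multiset"
begin

text \<open>
  The recursion sorts the \<open>a\<close>-parking functions of length \<open>n\<close> by the number \<open>k\<close> of entries equal
  to 1. Remove these entries and lower the others by one. In the sorted vector the ones come first,
  so the removal moves the \<open>i\<close>-th smallest remaining entry down from rank \<open>k + i\<close>, where its bound
  is \<open>a + k + i - 1\<close>; after lowering, its bound is \<open>(a + k - 1) + i - 1\<close>. Hence the remaining
  entries form an \<open>(a + k - 1)\<close>-parking function of length \<open>n - k\<close>, and the ones themselves satisfy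
  their bounds because \<open>a \<ge> 1\<close> (lemma \<open>parking_function_iff_remove_ones\<close>).

  Conversely, a vector \<open>qs\<close> of length \<open>n - k\<close> arises from exactly \<open>n choose k\<close> vectors, one for each
  choice of the positions of the ones. These vectors are the shuffles of \<open>k\<close> ones with \<open>map Suc qs\<close>;
  as no entry of \<open>qs\<close> is 0, the two shuffled lists have no common entry, so that the number of
  shuffles is a binomial coefficient and each vector determines \<open>k\<close> and \<open>qs\<close>. Thus the parking
  functions are a disjoint union of sets of shuffles (lemma \<open>parking_functions_eq_Union_shuffles\<close>).
\<close>

text \<open>
  Ranks counted from 0 avoid the subtractions. The upper bound on single entries is implied by
  the bounds on the order statistics, since every entry has some rank below \<open>length ps\<close>.
\<close>

lemma parking_function_iff_nth_sort:
  "parking_function a ps \<longleftrightarrow> 0 \<notin> set ps \<and> (\<forall>i<length ps. sort ps ! i \<le> a + i)"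
proof -
  have ranks: "(\<forall>i\<in>{1..length ps}. sort ps ! (i - 1) \<le> a + i - 1) \<longleftrightarrow>
               (\<forall>i<length ps. sort ps ! i \<le> a + i)"
  proof (intro iffI ballI allI impI)
    fix i assume "\<forall>i\<in>{1..length ps}. sort ps ! (i - 1) \<le> a + i - 1" "i < length ps"
    then show "sort ps ! i \<le> a + i" by (auto dest!: bspec[of _ _ "Suc i"])
  next
    fix i assume "\<forall>i<length ps. sort ps ! i \<le> a + i" "i \<in> {1..length ps}"
    then show "sort ps ! (i - 1) \<le> a + i - 1" by (auto dest!: spec[of _ "i - 1"])
  qed
  have "x \<le> length ps + a - 1"
    if bound: "\<forall>i<length ps. sort ps ! i \<le> a + i" and "x \<in> set ps" for x
  proof -
    have "x \<in> set (sort ps)" using that by simp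
    then obtain i where "i < length ps" "sort ps ! i = x" by (metis in_set_conv_nth length_sort)
    then show ?thesis using bound by fastforce
  qed
  then show ?thesis
    unfolding parking_function_def ranks by (metis One_nat_def Suc_leI not_gr_zero not_one_le_zero)
qed

lemma sort_shuffle_ones:
  assumes "ps \<in> shuffles (replicate k 1) (map Suc qs)"
  shows "sort ps = replicate k 1 @ map Suc (sort qs)"
proof (rule properties_for_sort)
  show "mset (replicate k 1 @ map Suc (sort qs)) = mset ps"
    using assms by (simp add: mset_shuffles)
  show "sorted (replicate k 1 @ map Suc (sort qs))"
    by (auto simp: sorted_append sorted_map)
qed

text \<open>
  Deleting \<open>k\<close> ones lowers the ranks by \<open>k\<close>, and decrementing lowers the values by one; the
  bounds are preserved when the parameter changes from \<open>a\<close> to \<open>a + k - 1\<close>.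
\<close>

lemma parking_function_iff_remove_ones:
  assumes "a \<ge> 1" and "0 \<notin> set qs" and ps: "ps \<in> shuffles (replicate k 1) (map Suc qs)"
  shows "parking_function a ps \<longleftrightarrow> parking_function (a + k - 1) qs"
proof -
  have len: "length ps = k + length qs"
    using length_shuffles[OF ps] by simp
  have "0 \<notin> set ps"
    using set_shuffles[OF ps] by auto
  moreover have "(\<forall>i<length ps. sort ps ! i \<le> a + i) \<longleftrightarrow>
                 (\<forall>i<length qs. sort qs ! i \<le> a + k - 1 + i)"
  proof (intro iffI allI impI)
    fix i assume "\<forall>i<length ps. sort ps ! i \<le> a + i" "i < length qs"
    then have "sort ps ! (k + i) \<le> a + (k + i)" by (simp add: len)
    then show "sort qs ! i \<le> a + k - 1 + i"
      using \<open>i < length qs\<close> by (simp add: sort_shuffle_ones[OF ps] nth_append)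
  next
    fix i assume bound: "\<forall>i<length qs. sort qs ! i \<le> a + k - 1 + i" and "i < length ps"
    show "sort ps ! i \<le> a + i"
    proof (cases "i < k")
      case True
      then show ?thesis using \<open>a \<ge> 1\<close> by (simp add: sort_shuffle_ones[OF ps] nth_append)
    next
      case False
      then have "i - k < length qs" using \<open>i < length ps\<close> len by simp
      moreover from this bound have "sort qs ! (i - k) \<le> a + k - 1 + (i - k)" by blast
      ultimately show ?thesis
        using False \<open>a \<ge> 1\<close> by (simp add: sort_shuffle_ones[OF ps] nth_append)
    qed
  qed
  ultimately show ?thesis
    using assms(2) by (simp add: parking_function_iff_nth_sort)
qed

lemma zero_notin_parking_function: "qs \<in> parking_functions n a \<Longrightarrow> 0 \<notin> set qs"
  by (simp add: parking_functions_def parking_function_iff_nth_sort)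

text \<open>
  As \<open>map Suc qs\<close> contains no 1, splitting a shuffle into its ones and its other entries recovers
  both lists. Hence distinct pairs \<open>(k, qs)\<close> of this kind have disjoint sets of shuffles, which
  makes the union in the decomposition of the parking functions disjoint.
\<close>

lemma shuffle_ones_unique:
  assumes "0 \<notin> set qs" "0 \<notin> set rs"
    and "ps \<in> shuffles (replicate k 1) (map Suc qs)" "ps \<in> shuffles (replicate l 1) (map Suc rs)"
  shows "k = l \<and> qs = rs"
proof -
  have partition_eq: "partition (\<lambda>x. x = 1) ps = (replicate k 1, map Suc qs)"
    if "0 \<notin> set qs" "ps \<in> shuffles (replicate k 1) (map Suc qs)" for k qs
  proof -
    have "partition (\<lambda>x. x = 1) -` {(replicate k 1, map Suc qs)} =
          shuffles (replicate k 1) (map Suc qs)"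
      by (rule inv_image_partition) (use that in auto)
    then show ?thesis using that by blast
  qed
  have "replicate k (1::nat) = replicate l 1" "map Suc qs = map Suc rs"
    using partition_eq[OF assms(1,3)] partition_eq[OF assms(2,4)] by auto
  then show ?thesis by (auto dest: arg_cong[of _ _ length] simp: inj_map_eq_map)
qed

lemma card_shuffles_ones:
  assumes "0 \<notin> set qs"
  shows "card (shuffles (replicate k 1) (map Suc qs)) = (k + length qs) choose k"
proof -
  have "set (replicate k 1) \<inter> set (map Suc qs) = {}"
    using assms by auto
  from card_disjoint_shuffles[OF this] show ?thesis by simp
qed

lemma parking_functions_eq_Union_shuffles:
  assumes "a \<ge> 1"
  shows "parking_functions n a =
         (\<Union>(k, qs) \<in> (SIGMA k:{0..n}. parking_functions (n - k) (a + k - 1)).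
            shuffles (replicate k 1) (map Suc qs))" (is "_ = ?R")
proof (intro equalityI subsetI)
  fix ps assume ps: "ps \<in> parking_functions n a"
  define k where "k = length (filter (\<lambda>x. x = 1) ps)"
  define qs where "qs = map (\<lambda>x. x - 1) (filter (\<lambda>x. x \<noteq> 1) ps)"
  have entries: "x \<ge> 1" if "x \<in> set ps" for x
    using zero_notin_parking_function[OF ps] that by (cases x) auto
  then have nz: "0 \<notin> set qs" by (fastforce simp: qs_def)
  have ones: "filter (\<lambda>x. x = 1) ps = replicate k 1"
    unfolding k_def by (induction ps) auto
  have rest: "map Suc qs = filter (\<lambda>x. x \<noteq> 1) ps"
    using entries by (force simp: qs_def intro!: map_idI)
  have shuffle: "ps \<in> shuffles (replicate k 1) (map Suc qs)"
    using partition_in_shuffles[of ps "\<lambda>x. x = 1"] by (simp only: ones rest)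
  have "length ps = n" "parking_function a ps"
    using ps by (auto simp: parking_functions_def)
  moreover have "length ps = k + length qs"
    using length_shuffles[OF shuffle] by simp
  ultimately have "k \<le> n" "qs \<in> parking_functions (n - k) (a + k - 1)"
    using parking_function_iff_remove_ones[OF assms nz shuffle]
    by (auto simp: parking_functions_def)
  with shuffle show "ps \<in> ?R" by fastforce
next
  fix ps assume "ps \<in> ?R"
  then obtain k qs where "k \<le> n" and qs: "qs \<in> parking_functions (n - k) (a + k - 1)"
    and shuffle: "ps \<in> shuffles (replicate k 1) (map Suc qs)" by auto
  then show "ps \<in> parking_functions n a"
    using parking_function_iff_remove_ones[OF assms zero_notin_parking_function[OF qs] shuffle]
      length_shuffles[OF shuffle]
    by (simp add: parking_functions_def)
qed

lemma num_parking_recursion: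
  assumes "a \<ge> 1"
  shows "num_parking n a = (\<Sum>k=0..n. (n choose k) * num_parking (n - k) (a + k - 1))"
proof -
  let ?S = "SIGMA k:{0..n}. parking_functions (n - k) (a + k - 1)"
  let ?A = "\<lambda>(k, qs). shuffles (replicate k (1::nat)) (map Suc qs)"
  have "card (\<Union>s\<in>?S. ?A s) = (\<Sum>s\<in>?S. card (?A s))"
  proof (rule card_UN_disjoint)
    show "finite ?S" by (intro finite_SigmaI finite_parking_functions) simp
    show "\<forall>s\<in>?S. finite (?A s)" by auto
    show "\<forall>s\<in>?S. \<forall>t\<in>?S. s \<noteq> t \<longrightarrow> ?A s \<inter> ?A t = {}"
      by (fastforce dest: zero_notin_parking_function shuffle_ones_unique)
  qed
  also have "\<dots> = (\<Sum>s\<in>?S. n choose fst s)"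
  proof (rule sum.cong[OF refl], clarify)
    fix k qs assume "k \<in> {0..n}" and qs: "qs \<in> parking_functions (n - k) (a + k - 1)"
    then have "k + length qs = n" by (simp add: parking_functions_def)
    then show "card (shuffles (replicate k (1::nat)) (map Suc qs)) = n choose fst (k, qs)"
      using card_shuffles_ones[OF zero_notin_parking_function[OF qs], of k] by simp
  qed
  also have "\<dots> = (\<Sum>k=0..n. \<Sum>qs\<in>parking_functions (n - k) (a + k - 1). n choose k)"
    by (subst sum.Sigma) (auto simp: finite_parking_functions case_prod_beta)
  finally show ?thesis
    by (simp add: num_parking_def parking_functions_eq_Union_shuffles[OF assms, of n] mult.commute)
qed

text \<open>For \<open>a = 0\<close> the smallest entry of a nonempty parking function would have to be 0.\<close>

lemma num_parking_zero_right:
  assumes "n \<ge> 1"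
  shows "num_parking n 0 = 0"
proof -
  have False if ps: "ps \<in> parking_functions n 0" for ps
  proof -
    have "length ps = n" "sort ps ! 0 = 0"
      using ps assms by (fastforce simp: parking_functions_def parking_function_iff_nth_sort)+
    then have "0 \<in> set (sort ps)"
      using assms by (metis One_nat_def Suc_le_eq length_sort nth_mem)
    then show False using zero_notin_parking_function[OF ps] by simp
  qed
  then have "parking_functions n 0 = {}" by blast
  then show ?thesis by (simp add: num_parking_def)
qed

lemma num_parking_zero_left: "num_parking 0 a = 1"
proof -
  have "parking_functions 0 a = {[]}"
    by (auto simp: parking_functions_def parking_function_iff_nth_sort)
  then show ?thesis by (simp add: num_parking_def)
qed

theorem proposition2p4:
  shows "(\<forall>n a. n \<ge> 1 \<longrightarrow> a \<ge> 1 \<longrightarrow>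
            num_parking n a = (\<Sum>k=0..n. (n choose k) * num_parking (n - k) (a + k - 1)))
       \<and> (\<forall>n. n \<ge> 1 \<longrightarrow> num_parking n 0 = 0)
       \<and> (\<forall>a. num_parking 0 a = 1)"
  using num_parking_recursion num_parking_zero_right num_parking_zero_left by blast

end
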